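(* Let $d\ge 3$ be an integer, let $c$ be an indeterminate and let $f_c(z)=z^{d+2}+cz^2$. For every positive integer $n$, the leading coefficient of $\Delta_{n,1}$ as a polynomial in $c$ is $\pm d^{d\varphi(n)}\Phi^{\mathrm{cyc}}_n(2)$. In particular, for all $n\ge 7$, this leading coefficient has a prime divisor $q$ such that $q\equiv 1\bmod n$.
   Context: $\varphi$ is Euler's totient function and $\Phi^{\mathrm{cyc}}_n(x)$ is the $n$-th cyclotomic polynomial. The first multiplier polynomial of $f_c$ is $\delta_1(x)=\prod_{f_c(\alpha)=\alpha}(x-f_c'(\alpha))\in\mathbb{Z}[c][x]$, the product over the $d+2$ roots $\alpha\in\overline{\mathbb{Q}(c)}$ of $f_c(z)-z$ with multiplicity. For $n>1$, $\Delta_{n,1}=\mathrm{Res}_x(\Phi^{\mathrm{cyc}}_n(x),\delta_1(x))=\prod_{\Phi^{\mathrm{cyc}}_n(\zeta)=0}\delta_1(\zeta)\in\mathbb{Z}[c]$, and $\Delta_{1,1}=\delta_1(1)$. *)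

theory Defs
  imports
    "HOL-Number_Theory.Number_Theory"
    "HOL-Algebra.Algebraic_Closure_Type"
    "Subresultants.Resultant_Prelim"
begin

definition primitive_roots_of_unity :: "nat \<Rightarrow> complex set" where
  "primitive_roots_of_unity n = {\<zeta>. \<zeta> ^ n = 1 \<and> (\<forall>k\<in>{0<..<n}. \<zeta> ^ k \<noteq> 1)}"

text \<open>The product over the primitive complex roots of unity has integer coefficients for
  \<open>n > 0\<close> (lemma \<open>of_int_poly_cyclotomic\<close>), so the description below is well defined.\<close>

definition cyclotomic :: "nat \<Rightarrow> int poly" where
  "cyclotomic n = (THE p. map_poly of_int p = (\<Prod>\<zeta>\<in>primitive_roots_of_unity n. [:-\<zeta>, 1:]))"

definition f_poly :: "nat \<Rightarrow> 'a :: comm_ring_1 \<Rightarrow> 'a poly" where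
  "f_poly d c = monom 1 (d + 2) + monom c 2"

text \<open>The inner variable of \<open>int poly\<close> and \<open>rat poly\<close> is the indeterminate \<open>c\<close>, so
  \<open>rat poly fract\<close> is $\mathbb{Q}(c)$; in \<open>int poly poly\<close> the outer variable is \<open>x\<close>.
  The map \<open>emb\<close> is the inclusion of $\mathbb{Z}[c]$ into the algebraic closure of
  $\mathbb{Q}(c)$.\<close>

type_synonym alg_Qc = "rat poly fract alg_closure"

definition emb :: "int poly \<Rightarrow> alg_Qc" where
  "emb p = to_ac (to_fract (map_poly rat_of_int p))"

text \<open>\<open>proots\<close> is the multiset of roots, hence the product counts the fixed points with
  multiplicity.\<close>

definition delta1_ac :: "nat \<Rightarrow> alg_Qc poly" where
  "delta1_ac d = (let f = f_poly d (emb [:0, 1:])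
     in \<Prod>\<alpha>\<in>#proots (f - [:0, 1:]). [:- poly (pderiv f) \<alpha>, 1:])"

text \<open>The element of $\mathbb{Z}[c][x]$ given by the product above; it exists and is unique
  for \<open>d > 0\<close> (lemma \<open>map_poly_emb_delta1\<close>).\<close>

definition delta1 :: "nat \<Rightarrow> int poly poly" where
  "delta1 d = (THE p. map_poly emb p = delta1_ac d)"

text \<open>The resultant is taken with respect to \<open>x\<close>, with coefficients in $\mathbb{Z}[c]$; the
  cyclotomic polynomial is regarded in $\mathbb{Z}[c][x]$ through its constant coefficients.
  The value at \<open>n = 0\<close> is irrelevant.\<close>

definition Delta1 :: "nat \<Rightarrow> nat \<Rightarrow> int poly" where
  "Delta1 d n = (if n = 1 then poly (delta1 d) 1
     else resultant (map_poly (\<lambda>a. [:a:]) (cyclotomic n)) (delta1 d))"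


lemma emb_hom: "inj_comm_ring_hom emb"
proof
  show "emb (p + q) = emb p + emb q" for p q
    unfolding emb_def by (metis of_int_poly_hom.hom_add to_fract_add to_ac_add)
  show "emb (p * q) = emb p * emb q" for p q
    unfolding emb_def by (metis of_int_poly_hom.hom_mult to_fract_mult to_ac_mult)
  show "p = 0" if "emb p = 0" for p
    using that by (simp add: emb_def)
qed (simp_all add: emb_def)

lemma linear_factors_substitution:
  fixes a e :: "'a :: field"
  assumes a: "a \<noteq> 0"
  shows "(\<Prod>\<beta>\<in>#A. [:a * \<beta> - e, 1:]) =
           smult ((- a) ^ size A) (pcompose (\<Prod>\<beta>\<in>#A. [:- \<beta>, 1:]) [:e / a, - (1 / a):])"
proof (induction A)
  case empty
  show ?case by simp
next
  case (add \<beta> A)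
  have "[:a * \<beta> - e, 1:] = smult (- a) (pcompose [:- \<beta>, 1:] [:e / a, - (1 / a):])"
    using a by (simp add: pcompose_pCons field_simps)
  then have "(\<Prod>\<beta>\<in>#add_mset \<beta> A. [:a * \<beta> - e, 1:]) =
      smult (- a) (pcompose [:- \<beta>, 1:] [:e / a, - (1 / a):]) *
      smult ((- a) ^ size A) (pcompose (\<Prod>\<beta>\<in>#A. [:- \<beta>, 1:]) [:e / a, - (1 / a):])"
    by (simp only: image_mset_add_mset prod_mset.add_mset add.IH)
  also have "\<dots> = smult ((- a) ^ size (add_mset \<beta> A))
      (pcompose (\<Prod>\<beta>\<in>#add_mset \<beta> A. [:- \<beta>, 1:]) [:e / a, - (1 / a):])"
    by (simp only: image_mset_add_mset prod_mset.add_mset pcompose_mult mult_smult_left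
        mult_smult_right smult_smult size_add_mset power_Suc mult.commute)
  finally show ?case .
qed

lemma pcompose_monom_one: "pcompose (monom 1 k) (r :: 'a :: comm_ring_1 poly) = r ^ k"
  by (induction k) (simp_all add: monom_Suc pcompose_pCons pcompose_1 monom_0 flip: one_pCons)

lemma delta1_ac_integral:
  assumes d: "d > 0"
  shows "\<exists>p. map_poly emb p = delta1_ac d"
proof -
  interpret emb: inj_comm_ring_hom emb by (rule emb_hom)
  interpret embp: map_poly_inj_comm_ring_hom emb ..
  define c where "c = emb [:0, 1:]"
  define f where "f = f_poly d c"
  define Q where "Q = monom 1 (d + 1) + [:-1, c:]"
  define m where "m = d + 1"
  define a where "a = of_nat d * c"
  define e :: alg_Qc where "e = of_nat (d + 2)"
  have a_emb: "a = emb (of_nat d * [:0, 1:])"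
    unfolding a_def c_def by (simp only: emb.hom_mult emb.hom_of_nat)
  have a0: "a \<noteq> 0"
    unfolding a_emb using d by simp
  have fQ: "f - [:0, 1:] = [:0, 1:] * Q"
    unfolding f_def f_poly_def Q_def
    by (simp add: monom_altdef algebra_simps power2_eq_square smult_add_right)
  have degQ: "degree Q = m" and lcQ: "lead_coeff Q = 1"
  proof -
    have "degree [:-1, c:] < degree (monom (1 :: alg_Qc) (d + 1))"
      using d by (simp add: degree_monom_eq)
    then show "degree Q = m"
      unfolding Q_def m_def by (subst degree_add_eq_left) (auto simp: degree_monom_eq)
    then show "lead_coeff Q = 1"
      using d by (simp add: Q_def m_def coeff_pCons split: nat.splits)
  qed
  have Q0: "Q \<noteq> 0" using lcQ by auto
  obtain A where A: "size A = m" "Q = (\<Prod>\<beta>\<in>#A. [:-\<beta>, 1:])"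
    using alg_closed_imp_factorization[OF Q0] degQ lcQ by auto
  have prQ: "proots Q = A"
  proof -
    have "proots (\<Prod>\<beta>\<in>#B. [:-\<beta>, 1:]) = B" for B :: "alg_Qc multiset"
    proof (induction B)
      case (add x B)
      have "(\<Prod>\<beta>\<in>#B. [:-\<beta>, 1:]) \<noteq> 0" by (auto simp: prod_mset_zero_iff)
      with add show ?case
        by (simp add: proots_mult del: mult_pCons_left)
    qed simp
    then show ?thesis unfolding A(2) .
  qed
  have "proots (f - [:0, 1:]) = {#0#} + A"
    using Q0 by (simp add: fQ proots_mult prQ del: mult_pCons_left)
  then have D: "delta1_ac d = [:- poly (pderiv f) 0, 1:] * (\<Prod>\<beta>\<in>#A. [:- poly (pderiv f) \<beta>, 1:])"
    by (simp add: delta1_ac_def f_def c_def Let_def del: mult_pCons_left)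
  have pd: "poly (pderiv f) x = of_nat (d + 2) * x ^ (d + 1) + 2 * c * x" for x
    unfolding f_def f_poly_def by (simp add: pderiv_add pderiv_monom poly_monom)
  have "poly (pderiv f) \<beta> = e - a * \<beta>" if "\<beta> \<in># A" for \<beta>
  proof -
    have "\<beta> \<in> set_mset (proots Q)" using that by (simp only: prQ)
    then have "poly Q \<beta> = 0" unfolding set_count_proots[OF Q0] by simp
    then have \<beta>: "\<beta> ^ (d + 1) = 1 - c * \<beta>"
      by (simp add: Q_def poly_monom algebra_simps eq_neg_iff_add_eq_0)
    show ?thesis unfolding pd \<beta> by (simp add: e_def a_def algebra_simps)
  qed
  then have "(\<Prod>\<beta>\<in>#A. [:- poly (pderiv f) \<beta>, 1:]) = (\<Prod>\<beta>\<in>#A. [:a * \<beta> - e, 1:])"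
    by (intro arg_cong[where f = prod_mset] image_mset_cong) simp
  also have "\<dots> = smult ((- a) ^ m) (pcompose Q [:e / a, - (1 / a):])"
    using linear_factors_substitution[OF a0] A by simp
  also have "pcompose Q [:e / a, - (1 / a):] = [:e / a, - (1 / a):] ^ m + pcompose [:-1, c:] [:e / a, - (1 / a):]"
    by (simp only: Q_def m_def pcompose_add pcompose_monom_one)
  also have "smult ((- a) ^ m) \<dots> = [:- e, 1:] ^ m + smult ((- a) ^ m) (pcompose [:-1, c:] [:e / a, - (1 / a):])"
  proof -
    have "smult ((- a) ^ m) ([:e / a, - (1 / a):] ^ m) = (smult (- a) [:e / a, - (1 / a):]) ^ m"
      by (simp only: smult_power)
    also have "smult (- a) [:e / a, - (1 / a):] = [:- e, 1:]" using a0 by simp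
    finally show ?thesis by (simp only: smult_add_right)
  qed
  also have "smult ((- a) ^ m) (pcompose [:-1, c:] [:e / a, - (1 / a):]) =
      smult (- ((- a) ^ d)) [:- a + c * e, - c:]"
    using a0 by (simp add: pcompose_pCons m_def field_simps)
  finally have prod_eq: "(\<Prod>\<beta>\<in>#A. [:- poly (pderiv f) \<beta>, 1:]) =
      [:- e, 1:] ^ m + smult (- ((- a) ^ d)) [:- a + c * e, - c:]" .
  have "poly (pderiv f) 0 = 0" by (simp add: pd)
  then have "delta1_ac d = [:0, 1:] * ([:- e, 1:] ^ m + smult (- ((- a) ^ d)) [:- a + c * e, - c:])"
    by (simp only: D prod_eq minus_zero)
  also have "\<dots> = map_poly emb ([:0, 1:] * ([:- of_nat (d + 2), 1:] ^ m +
      smult (- ((- (of_nat d * [:0, 1:])) ^ d))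
        [:- (of_nat d * [:0, 1:]) + [:0, 1:] * of_nat (d + 2), - [:0, 1:]:]))"
    unfolding a_emb c_def e_def
    by (simp only: embp.hom_mult embp.hom_add embp.hom_power emb.map_poly_hom_smult
        emb.map_poly_pCons_hom emb.hom_zero emb.hom_one emb.hom_uminus emb.hom_add
        emb.hom_mult emb.hom_power emb.hom_of_nat map_poly_0)
  finally show ?thesis by metis
qed

lemma delta1_unique:
  assumes "map_poly emb p = delta1_ac d"
  shows "delta1 d = p"
proof -
  interpret emb: inj_comm_ring_hom emb by (rule emb_hom)
  interpret embp: map_poly_inj_comm_ring_hom emb ..
  show ?thesis
    unfolding delta1_def
  proof (rule the_equality)
    fix q assume "map_poly emb q = delta1_ac d"
    with assms have "map_poly emb q = map_poly emb p" by simp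
    then show "q = p" by (rule embp.injectivity)
  qed (fact assms)
qed

lemma map_poly_emb_delta1: "d > 0 \<Longrightarrow> map_poly emb (delta1 d) = delta1_ac d"
  using delta1_ac_integral delta1_unique by metis

lemma finite_roots_unity_complex: "n > 0 \<Longrightarrow> finite {\<zeta> :: complex. \<zeta> ^ n = 1}"
  using finite_roots_unity[of n] by simp

lemma prod_roots_of_unity:
  assumes n: "n > 0"
  shows "(\<Prod>\<zeta> | \<zeta> ^ n = 1. [:- \<zeta>, 1:]) = monom 1 n - (1 :: complex poly)"
proof (rule ccontr)
  let ?P = "(\<Prod>\<zeta> | \<zeta> ^ n = 1. [:- \<zeta>, 1:]) :: complex poly"
  let ?R = "?P - (monom 1 n - 1)"
  assume "?P \<noteq> monom 1 n - 1"
  then have R0: "?R \<noteq> 0" by simp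
  have fin: "finite {\<zeta> :: complex. \<zeta> ^ n = 1}" by (rule finite_roots_unity_complex[OF n])
  have degP: "degree ?P = n"
    by (subst degree_prod_sum_eq) (auto simp: card_roots_unity_eq n)
  have lcP: "coeff ?P n = 1"
    using lead_coeff_prod[of "\<lambda>\<zeta>. [:- \<zeta>, 1:]" "{\<zeta> :: complex. \<zeta> ^ n = 1}"] degP by simp
  have "degree ?R < n"
  proof -
    have "degree (monom 1 n - 1 :: complex poly) \<le> n"
      by (intro degree_diff_le) (auto simp: degree_monom_le)
    then have "degree ?R \<le> n" using degP by (intro degree_diff_le) (simp_all add: degree_monom_le)
    moreover have "coeff ?R n = 0" using lcP n by simp
    ultimately show ?thesis using R0
      by (metis leading_coeff_0_iff le_neq_implies_less)
  qed
  moreover have "{\<zeta> :: complex. \<zeta> ^ n = 1} \<subseteq> {x. poly ?R x = 0}"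
    using fin by (auto simp: poly_prod poly_monom prod_zero_iff)
  then have "n \<le> card {x. poly ?R x = 0}"
    using card_mono[OF poly_roots_finite[OF R0]] card_roots_unity_eq[OF n] by metis
  ultimately show False using card_poly_roots_bound[OF R0] by linarith
qed

lemma roots_of_unity_partition:
  assumes n: "n > 0"
  shows "{\<zeta> :: complex. \<zeta> ^ n = 1} = (\<Union>k\<in>{k. k dvd n}. primitive_roots_of_unity k)"
proof (intro equalityI subsetI)
  fix \<zeta> :: complex assume "\<zeta> \<in> {\<zeta>. \<zeta> ^ n = 1}"
  then have z: "\<zeta> ^ n = 1" by simp
  define k where "k = (LEAST k. k > 0 \<and> \<zeta> ^ k = 1)"
  have k: "k > 0" "\<zeta> ^ k = 1"
    using LeastI[of "\<lambda>k. k > 0 \<and> \<zeta> ^ k = 1" n] n z unfolding k_def by auto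
  have min: "\<zeta> ^ j \<noteq> 1" if "0 < j" "j < k" for j
    using not_less_Least[of j "\<lambda>k. k > 0 \<and> \<zeta> ^ k = 1"] that unfolding k_def by auto
  have "\<zeta> ^ (n mod k) = \<zeta> ^ (k * (n div k) + n mod k)"
    by (simp only: power_add power_mult k power_one mult_1)
  then have "\<zeta> ^ (n mod k) = 1" using z by simp
  then have "n mod k = 0" using min[of "n mod k"] k(1) by (metis gr0I mod_less_divisor)
  then show "\<zeta> \<in> (\<Union>k\<in>{k. k dvd n}. primitive_roots_of_unity k)"
    using k min by (auto simp: primitive_roots_of_unity_def)
qed (auto simp: primitive_roots_of_unity_def power_mult elim!: dvdE)

lemma primitive_roots_of_unity_disjoint:
  assumes "k > 0" "l > 0" "k \<noteq> l"
  shows "primitive_roots_of_unity k \<inter> primitive_roots_of_unity l = {}"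
  using assms by (cases k l rule: linorder_cases) (auto simp: primitive_roots_of_unity_def)

lemma cyclotomic_integral:
  "n > 0 \<Longrightarrow> \<exists>p :: int poly. map_poly of_int p = (\<Prod>\<zeta>\<in>primitive_roots_of_unity n. [:- \<zeta>, 1:])"
proof (induction n rule: less_induct)
  case (less n)
  define C where "C k = (\<Prod>\<zeta>\<in>primitive_roots_of_unity k. [:- \<zeta>, 1:])" for k
  have finp: "finite (primitive_roots_of_unity k)" if "k > 0" for k
    by (rule finite_subset[OF _ finite_roots_unity_complex[OF that]])
       (auto simp: primitive_roots_of_unity_def)
  define D where "D = {k. k dvd n \<and> k < n}"
  have Dpos: "k > 0" if "k \<in> D" for k using that less.prems by (auto simp: D_def)
  have finD: "finite D" by (simp add: D_def)
  have divs: "{k. k dvd n} = insert n D" "n \<notin> D"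
    using less.prems by (auto simp: D_def dest: dvd_imp_le)
  have "\<forall>k\<in>D. \<exists>p :: int poly. map_poly of_int p = C k"
    using less.IH Dpos by (auto simp: D_def C_def)
  then obtain p where p: "\<And>k. k \<in> D \<Longrightarrow> map_poly of_int (p k :: int poly) = C k" by metis
  define Q where "Q = (\<Prod>k\<in>D. p k)"
  have hQ: "map_poly of_int Q = (\<Prod>k\<in>D. C k)"
    unfolding Q_def of_int_poly_hom.hom_prod using p by (intro prod.cong) auto
  have prod: "(\<Prod>k\<in>D. C k) * C n = map_poly of_int (monom 1 n - 1 :: int poly)"
  proof -
    have "map_poly of_int (monom 1 n - 1 :: int poly) = (monom 1 n - 1 :: complex poly)"
      by (simp add: hom_distribs)
    also have "\<dots> = (\<Prod>\<zeta>\<in>(\<Union>k\<in>insert n D. primitive_roots_of_unity k). [:- \<zeta>, 1:])"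
      using prod_roots_of_unity[OF less.prems] roots_of_unity_partition[OF less.prems] divs by simp
    also have "\<dots> = (\<Prod>k\<in>insert n D. C k)"
      unfolding C_def using finD finp Dpos less.prems
      by (intro prod.UNION_disjoint ballI impI primitive_roots_of_unity_disjoint) auto
    finally show ?thesis using divs(2) finD by (simp add: mult.commute)
  qed
  have "lead_coeff (map_poly of_int Q :: complex poly) = 1"
    unfolding hQ C_def by (simp add: lead_coeff_prod)
  then have lcQ: "lead_coeff Q = 1"
    by simp
  then have Q0: "Q \<noteq> 0" by auto
  obtain A R where AR: "pseudo_divmod (monom 1 n - 1) Q = (A, R)" by force
  have eq: "monom 1 n - 1 = Q * A + R" and degR: "R = 0 \<or> degree R < degree Q"
    using pseudo_divmod[OF Q0 AR] lcQ by auto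
  let ?h = "map_poly of_int :: int poly \<Rightarrow> complex poly"
  have e2: "?h Q * (C n - ?h A) = ?h R"
    using prod hQ by (simp add: eq hom_distribs algebra_simps)
  have "C n = ?h A"
  proof (rule ccontr)
    assume "C n \<noteq> ?h A"
    then have nz: "C n - ?h A \<noteq> 0" by simp
    have hQ0: "?h Q \<noteq> 0" using Q0 by simp
    have "?h R \<noteq> 0" using e2 nz hQ0 by (metis mult_eq_0_iff)
    then have "R \<noteq> 0" by auto
    moreover have "degree (?h R) \<ge> degree (?h Q)"
      using degree_mult_eq[OF hQ0 nz] e2 by simp
    ultimately show False using degR by simp
  qed
  then show ?case unfolding C_def by metis
qed

lemma of_int_poly_cyclotomic:
  assumes "n > 0"
  shows "map_poly of_int (cyclotomic n) = (\<Prod>\<zeta>\<in>primitive_roots_of_unity n. [:- \<zeta>, 1:])"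
proof -
  obtain p :: "int poly"
    where p: "map_poly of_int p = (\<Prod>\<zeta>\<in>primitive_roots_of_unity n. [:- \<zeta>, 1:])"
    using cyclotomic_integral[OF assms] by blast
  show ?thesis
    unfolding cyclotomic_def
  proof (rule theI[of _ p])
    fix q :: "int poly"
    assume "map_poly of_int q = (\<Prod>\<zeta>\<in>primitive_roots_of_unity n. [:- \<zeta>, 1:])"
    with p have "map_poly complex_of_int q = map_poly complex_of_int p" by (simp only:)
    then show "q = p" by (simp only: of_int_poly_hom.eq_iff)
  qed (fact p)
qed

end

theory Submission
  imports Defs
begin

text \<open>
  Away from the fixed point \<open>0\<close>, a fixed point \<open>\<alpha>\<close> of \<open>f\<^sub>c\<close> satisfies
  \<open>\<alpha> ^ (d + 1) + c * \<alpha> = 1\<close>, and this relation makes the multiplier affine in \<open>\<alpha>\<close>: it equals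
  \<open>d + 2 - d * c * \<alpha>\<close>. Hence \<open>\<delta>\<^sub>1\<close> is an affine substitution into the polynomial
  \<open>z ^ (d + 1) + c * z - 1\<close>, which gives the closed form (lemma \<open>delta1_eq\<close>)
  \<open>\<delta>\<^sub>1(x) = x * ((x - d - 2) ^ (d + 1) - (- d) ^ d * c ^ (d + 1) * (2 - x))\<close>.
  At a number \<open>\<zeta>\<close> other than \<open>0\<close> and \<open>2\<close> its leading coefficient in \<open>c\<close> is
  \<open>- \<zeta> * (- d) ^ d * (2 - \<zeta>)\<close>. The resultant is the product of the values \<open>\<delta>\<^sub>1(\<zeta>)\<close> over the
  \<open>\<phi>(n)\<close> primitive roots of unity (lemma \<open>of_int_poly_Delta1\<close>), so its leading coefficient has
  absolute value \<open>d ^ (d * \<phi>(n)) * \<bar>\<Phi>\<^sub>n(2)\<bar>\<close>. The leading coefficient is an integer, hence its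
  absolute value determines it up to sign, and the roots of unity \<open>\<zeta>\<close>
  contribute only factors of modulus one.

  The second claim is then the theorem of Bang for the base \<open>2\<close>, that is, Zsigmondy's theorem for
  \<open>2 ^ n - 1\<close>: for \<open>n \<ge> 7\<close> the number \<open>\<Phi>\<^sub>n(2)\<close> has a prime divisor \<open>q\<close> for which \<open>2\<close> has order \<open>n\<close>
  modulo \<open>q\<close>. A prime divisor \<open>q\<close> of \<open>\<Phi>\<^sub>n(2)\<close> that is not \<open>1\<close> modulo \<open>n\<close>
  is severely restricted (lemma \<open>non_primitive_prime_divisor\<close>): \<open>n = m * q ^ k\<close> with
  \<open>k > 0\<close> and \<open>m\<close> dividing \<open>q - 1\<close>, so that \<open>q\<close> is the largest prime factor of \<open>n\<close>, and \<open>q\<^sup>2\<close> does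
  not divide \<open>\<Phi>\<^sub>n(2)\<close>. If all prime divisors were of this kind, then \<open>\<bar>\<Phi>\<^sub>n(2)\<bar> = q\<close>. But
  \<open>\<Phi>\<^sub>n(2)\<close> is too large for that (lemma \<open>cyclotomic_two_gt_prime\<close>): with \<open>n = q * r\<close> it is
  \<open>\<Phi>\<^sub>r(2 ^ q)\<close> or \<open>\<Phi>\<^sub>r(2 ^ q) / \<Phi>\<^sub>r(2)\<close>, and \<open>2 ^ q\<close> is large compared with \<open>q\<close>.
\<close>

unbundle no fps_syntax

section \<open>Resultants as products over roots\<close>

text \<open>A row of the Sylvester matrix lists coefficients in descending order of degree, which is
  why the sum below runs downwards.\<close>
lemma poly_eq_sum_coeffs_below:
  assumes "degree p < n"
  shows "poly p (x :: 'a :: comm_ring_1) = (\<Sum>j<n. coeff p (n - 1 - j) * x ^ (n - 1 - j))"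
proof -
  have "(\<Sum>j<n. coeff p (n - 1 - j) * x ^ (n - 1 - j)) = (\<Sum>i<n. coeff p i * x ^ i)"
    using sum.nat_diff_reindex[of "\<lambda>i. coeff p i * x ^ i" n] by simp
  also have "\<dots> = (\<Sum>i\<le>degree p. coeff p i * x ^ i)"
    using assms by (intro sum.mono_neutral_right) (auto simp: coeff_eq_0)
  finally show ?thesis by (simp add: poly_altdef)
qed

text \<open>A nonzero vector in the kernel of the transpose is the coefficient vector of a nonzero
  polynomial of degree less than \<open>m\<close> that vanishes at \<open>m\<close> distinct points.\<close>
lemma det_vandermonde_nonzero:
  fixes z :: "nat \<Rightarrow> 'a :: idom"
  assumes inj: "inj_on z {..<m}"
  shows "det (mat m m (\<lambda>(i, k). z k ^ (m - 1 - i))) \<noteq> 0"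
proof
  define V where "V = mat m m (\<lambda>(k, i). z k ^ (m - 1 - i))"
  have V: "V \<in> carrier_mat m m" by (simp add: V_def)
  assume "det (mat m m (\<lambda>(i, k). z k ^ (m - 1 - i))) = 0"
  also have "mat m m (\<lambda>(i, k). z k ^ (m - 1 - i)) = transpose_mat V"
    by (auto simp: V_def)
  finally have "det V = 0" using det_transpose[OF V] by simp
  then obtain v where v: "v \<in> carrier_vec m" "v \<noteq> 0\<^sub>v m" "V *\<^sub>v v = 0\<^sub>v m"
    using det_0_iff_vec_prod_zero[OF V] by blast
  define P where "P = (\<Sum>i<m. monom (v $ i) (m - 1 - i))"
  have coeffP: "coeff P (m - 1 - i) = v $ i" if "i < m" for i
  proof -
    have "coeff P (m - 1 - i) = (\<Sum>j<m. if j = i then v $ j else 0)"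
      unfolding P_def coeff_sum using that by (intro sum.cong) auto
    then show ?thesis using that by simp
  qed
  have "P \<noteq> 0"
  proof
    assume "P = 0"
    then have "v $ i = 0" if "i < m" for i using coeffP[OF that] by simp
    then show False using v(1,2) by (metis carrier_vecD eq_vecI index_zero_vec)
  qed
  have "m > 0" using v by (metis carrier_vecD eq_vecI index_zero_vec(2) not_gr_zero not_less_zero)
  have "degree P \<le> m - 1"
    unfolding P_def by (intro degree_sum_le) (auto intro: order_trans[OF degree_monom_le])
  have "poly P (z k) = 0" if "k < m" for k
  proof -
    have "(V *\<^sub>v v) $ k = (\<Sum>i<m. z k ^ (m - 1 - i) * v $ i)"
      using that v(1) by (simp add: V_def scalar_prod_def atLeast0LessThan)
    also have "\<dots> = poly P (z k)"
      by (simp add: P_def poly_sum poly_monom mult.commute)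
    finally show ?thesis using v(3) that by simp
  qed
  then have "z ` {..<m} \<subseteq> {x. poly P x = 0}" by auto
  then have "m \<le> card {x. poly P x = 0}"
    by (metis card_mono[OF poly_roots_finite[OF \<open>P \<noteq> 0\<close>]] card_image[OF inj] card_lessThan)
  also have "\<dots> \<le> degree P" by (rule card_poly_roots_bound[OF \<open>P \<noteq> 0\<close>])
  finally show False using \<open>degree P \<le> m - 1\<close> \<open>m > 0\<close> by linarith
qed

text \<open>Multiplying a row of the Sylvester matrix by the column of powers of a root \<open>z\<^sub>k\<close> evaluates at
  \<open>z\<^sub>k\<close> the multiple \<open>x ^ j * p\<close> or \<open>x ^ j * q\<close> that the row represents. The multiples of \<open>p\<close>
  vanish there. Keeping the first \<open>n\<close> unit columns and replacing the other \<open>m\<close> by such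
  evaluation columns therefore makes the product block triangular: one diagonal block
  is unitriangular because \<open>p\<close> is monic, and the other is a Vandermonde matrix with its columns
  scaled by the values \<open>q(z\<^sub>k)\<close>. The Vandermonde determinant is also the determinant of the
  matrix of columns, and it cancels since the roots are distinct.\<close>
lemma resultant_prod_linear_indexed:
  fixes z :: "nat \<Rightarrow> 'a :: idom"
  assumes inj: "inj_on z {..<m}"
  shows "resultant (\<Prod>k<m. [:- z k, 1:]) q = (\<Prod>k<m. poly q (z k))"
proof -
  define p where "p = (\<Prod>k<m. [:- z k, 1:])"
  define n where "n = degree q"
  define N where "N = m + n"
  have degp: "degree p = m"
    unfolding p_def by (subst degree_prod_sum_eq) auto
  have lcp: "coeff p m = 1"
    using lead_coeff_prod[of "\<lambda>k. [:- z k, 1:]" "{..<m}"] degp by (simp add: p_def)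
  \<comment> \<open>\<open>r i\<close> is the polynomial whose coefficients form row \<open>i\<close> of the Sylvester matrix.\<close>
  define r where "r i = (if i < n then monom 1 (n - 1 - i) * p else monom 1 (N - 1 - i) * q)" for i
  define S where "S = sylvester_mat p q"
  have S: "S \<in> carrier_mat N N"
    unfolding S_def N_def n_def using sylvester_carrier_mat[of p q] degp by simp
  have Sij: "S $$ (i, j) = coeff (r i) (N - 1 - j)" if "i < N" "j < N" for i j
  proof (cases "i < n")
    case True
    then have "n - i = Suc (n - 1 - i)" "N - j = Suc (N - 1 - j)" using that by auto
    then have "coeff (monom 1 (n - i) * p) (N - j) = coeff (monom 1 (n - 1 - i) * p) (N - 1 - j)"
      by (simp only: monom_Suc mult_pCons_left coeff_pCons_Suc smult_0_left add_0_left)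
    then show ?thesis
      using that True sylvester_index_mat2[of i p q j] degp
      by (simp add: S_def r_def N_def n_def)
  next
    case False
    then have "N - i = Suc (N - 1 - i)" "N - j = Suc (N - 1 - j)" using that by auto
    then have "coeff (monom 1 (N - i) * q) (N - j) = coeff (monom 1 (N - 1 - i) * q) (N - 1 - j)"
      by (simp only: monom_Suc mult_pCons_left coeff_pCons_Suc smult_0_left add_0_left)
    then show ?thesis
      using that False sylvester_index_mat2[of i p q j] degp
      by (simp add: S_def r_def N_def n_def)
  qed
  have degr: "degree (r i) < N" if "i < N" for i
  proof -
    have "degree (monom 1 k * g) \<le> k + degree g" for k and g :: "'a poly"
      using degree_mult_le[of "monom 1 k" g] degree_monom_le[of "1 :: 'a" k] by linarith
    from this[of "n - 1 - i" p] this[of "N - 1 - i" q] show ?thesis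
      using that degp by (auto simp: r_def N_def n_def)
  qed
  define W where "W = mat N N (\<lambda>(j, c). if c < n then if j = c then 1 else 0 else z (c - n) ^ (N - 1 - j))"
  have W: "W \<in> carrier_mat N N" by (simp add: W_def)
  define V where "V = mat m m (\<lambda>(i, k). z k ^ (m - 1 - i))"
  define D where "D = mat m m (\<lambda>(i, k). if i = k then poly q (z k) else 0)"
  have VD: "V \<in> carrier_mat m m" "D \<in> carrier_mat m m" by (simp_all add: V_def D_def)
  have detW: "det W = det V"
  proof -
    have "transpose_mat W = four_block_mat (1\<^sub>m n) (0\<^sub>m n m)
        (mat m n (\<lambda>(k, j). z k ^ (N - 1 - j))) (transpose_mat V)"
      by (rule eq_matI) (auto simp: W_def V_def N_def)
    then show ?thesis
      using det_four_block_mat_upper_right_zero[of "1\<^sub>m n" n "0\<^sub>m n m" m _ "transpose_mat V"]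
        det_transpose[OF W] det_transpose[OF VD(1)] VD by simp
  qed
  have SW: "(S * W) $$ (i, c) = (if c < n then S $$ (i, c) else poly (r i) (z (c - n)))"
    if "i < N" "c < N" for i c
  proof -
    have "(S * W) $$ (i, c) = (\<Sum>j<N. S $$ (i, j) * W $$ (j, c))"
      using that S W by (simp add: scalar_prod_def atLeast0LessThan)
    also have "\<dots> = (if c < n then S $$ (i, c) else poly (r i) (z (c - n)))"
    proof (cases "c < n")
      case True
      have "(\<Sum>j<N. S $$ (i, j) * W $$ (j, c)) = (\<Sum>j<N. if j = c then S $$ (i, j) else 0)"
        using that True by (intro sum.cong) (auto simp: W_def)
      then show ?thesis using True that by simp
    next
      case False
      have "(\<Sum>j<N. S $$ (i, j) * W $$ (j, c)) =
          (\<Sum>j<N. coeff (r i) (N - 1 - j) * z (c - n) ^ (N - 1 - j))"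
        using that False by (intro sum.cong) (auto simp: W_def Sij)
      then show ?thesis using False poly_eq_sum_coeffs_below[OF degr[OF that(1)]] by simp
    qed
    finally show ?thesis .
  qed
  define T where "T = mat n n (\<lambda>(i, j). S $$ (i, j))"
  have pz: "poly p (z k) = 0" if "k < m" for k
    using that by (auto simp: p_def poly_prod prod_zero_iff)
  have VDij: "(V * D) $$ (i, k) = z k ^ (m - 1 - i) * poly q (z k)" if "i < m" "k < m" for i k
  proof -
    have "(V * D) $$ (i, k) = (\<Sum>j<m. z j ^ (m - 1 - i) * (if j = k then poly q (z k) else 0))"
      using that by (simp add: V_def D_def scalar_prod_def atLeast0LessThan)
    also have "\<dots> = (\<Sum>j<m. if j = k then z j ^ (m - 1 - i) * poly q (z j) else 0)"
      by (intro sum.cong) auto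
    finally show ?thesis using that by simp
  qed
  have "S * W = four_block_mat T (0\<^sub>m n m) (mat m n (\<lambda>(i, j). S $$ (n + i, j))) (V * D)"
    (is "_ = ?B")
  proof (rule eq_matI)
    show "dim_row (S * W) = dim_row ?B" "dim_col (S * W) = dim_col ?B"
      using S W by (auto simp: T_def V_def D_def N_def)
    fix i c assume "i < dim_row ?B" "c < dim_col ?B"
    then have ic: "i < N" "c < N" by (auto simp: T_def V_def D_def N_def)
    show "(S * W) $$ (i, c) = ?B $$ (i, c)"
      unfolding SW[OF ic] using ic VD
      by (auto simp: T_def N_def r_def pz poly_monom VDij simp del: index_mult_mat(1))
  qed
  then have "det (S * W) = det T * det (V * D)"
    using det_four_block_mat_upper_right_zero[of T n "0\<^sub>m n m" m _ "V * D"] VD by (simp add: T_def)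
  moreover have "det T = 1"
  proof -
    have Tij: "T $$ (i, j) = coeff p (m + i - j)" if "i < n" "j < n" "j \<le> m + i" for i j
      using that by (auto simp: T_def Sij N_def r_def coeff_monom_mult)
    have "upper_triangular T"
    proof
      fix i j assume ij: "j < i" "i < dim_row T"
      then have *: "i < n" "j < n" by (auto simp: T_def)
      have "m + i - j > m" using ij by simp
      then show "T $$ (i, j) = 0" using Tij[OF *] ij degp by (simp add: coeff_eq_0)
    qed
    then have "det T = prod_list (diag_mat T)"
      by (rule det_upper_triangular[where n = n]) (simp add: T_def)
    also have "diag_mat T = map (\<lambda>i. 1) [0..<n]"
      using Tij lcp by (auto simp: diag_mat_def T_def)
    finally show ?thesis by (simp add: map_replicate_const)
  qed
  moreover have "det D = (\<Prod>k<m. poly q (z k))"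
  proof -
    have "det D = prod_list (diag_mat D)"
      by (rule det_upper_triangular[OF _ VD(2)]) (auto simp: D_def)
    also have "diag_mat D = map (\<lambda>k. poly q (z k)) [0..<m]"
      by (auto simp: diag_mat_def D_def)
    finally show ?thesis
      by (simp add: prod.list_conv_set_nth atLeast0LessThan)
  qed
  ultimately have "det S * det V = det V * (\<Prod>k<m. poly q (z k))"
    using det_mult[OF S W] det_mult[OF VD] detW by simp
  moreover have "det V \<noteq> 0"
    unfolding V_def by (rule det_vandermonde_nonzero[OF inj])
  ultimately show ?thesis
    by (simp add: resultant_def S_def p_def mult.commute)
qed

lemma resultant_prod_linear:
  fixes Z :: "'a :: idom set"
  assumes "finite Z"
  shows "resultant (\<Prod>z\<in>Z. [:- z, 1:]) q = (\<Prod>z\<in>Z. poly q z)"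
proof -
  obtain z where z: "bij_betw z {..<card Z} Z"
    using ex_bij_betw_nat_finite[OF assms] by (auto simp: atLeast0LessThan)
  have "inj_on z {..<card Z}" using z by (simp add: bij_betw_def)
  from resultant_prod_linear_indexed[OF this, of q] show ?thesis
    by (simp only: prod.reindex_bij_betw[OF z, of "\<lambda>x. [:- x, 1:]"] prod.reindex_bij_betw[OF z, of "poly q"])
qed

section \<open>The first multiplier polynomial in closed form\<close>

lemma prod_mset_roots:
  fixes p :: "'a :: alg_closed_field poly"
  assumes "lead_coeff p = 1"
  shows "(\<Prod>x\<in>#proots p. [:- x, 1:]) = p" and "size (proots p) = degree p"
proof -
  obtain A where A: "size A = degree p" "p = (\<Prod>x\<in>#A. [:- x, 1:])"
    using alg_closed_imp_factorization[of p] assms by force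
  have "proots (\<Prod>x\<in>#A. [:- x, 1:]) = A"
  proof (induction A)
    case (add x A)
    have "(\<Prod>x\<in>#A. [:- x, 1:]) \<noteq> 0" by (auto simp: prod_mset_zero_iff)
    with add.IH show ?case by (simp add: proots_mult del: mult_pCons_left)
  qed simp
  then have "proots p = A" using A(2) by simp
  then show "(\<Prod>x\<in>#proots p. [:- x, 1:]) = p" and "size (proots p) = degree p"
    using A by simp_all
qed

text \<open>With \<open>Q = z ^ (d + 1) + c * z - 1\<close> one has \<open>f - z = z * Q\<close>. The fixed point \<open>0\<close> has multiplier \<open>0\<close>
  and gives the factor \<open>x\<close>. At a root \<open>\<beta>\<close> of \<open>Q\<close> the equation \<open>\<beta> ^ (d + 1) = 1 - c * \<beta>\<close> turns the
  multiplier into \<open>e - a * \<beta>\<close> with \<open>e = d + 2\<close> and \<open>a = d * c\<close>, so the remaining factors multiply to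
  \<open>(- a) ^ (d + 1) * Q((e - x) / a)\<close>. The term of \<open>Q\<close> of degree \<open>d + 1\<close> contributes
  \<open>(x - e) ^ (d + 1)\<close>, and the other two combine through \<open>c * (e - x) - a = c * (2 - x)\<close>.\<close>
lemma delta1_eq:
  assumes d: "d > 0"
  shows "delta1 d = [:0, 1:] * ([:- of_nat (d + 2), 1:] ^ (d + 1) -
    smult ((- of_nat d) ^ d * [:0, 1:] ^ (d + 1)) [:2, -1:])" (is "_ = ?rhs")
proof (rule delta1_unique)
  interpret emb: inj_comm_ring_hom emb by (rule emb_hom)
  interpret embp: map_poly_inj_comm_ring_hom emb ..
  define c where "c = emb [:0, 1:]"
  define f where "f = f_poly d c"
  define Q where "Q = monom 1 (d + 1) + [:-1, c:]"
  define a where "a = of_nat d * c"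
  define e :: alg_Qc where "e = of_nat (d + 2)"
  have "c \<noteq> 0" by (simp add: c_def)
  then have a0: "a \<noteq> 0" using d by (simp add: a_def)
  have fQ: "f - [:0, 1:] = [:0, 1:] * Q"
    by (simp add: f_def f_poly_def Q_def monom_altdef algebra_simps power2_eq_square)
  have "degree [:-1, c:] < degree (monom (1 :: alg_Qc) (d + 1))"
    using d by (simp add: degree_monom_eq)
  moreover have "coeff [:c:] d = 0" using d by (cases d) simp_all
  ultimately have degQ: "degree Q = d + 1" and lcQ: "lead_coeff Q = 1"
    unfolding Q_def by (simp_all add: degree_add_eq_left lead_coeff_add_le degree_monom_eq)
  then have "Q \<noteq> 0" by auto
  have pd: "poly (pderiv f) x = of_nat (d + 2) * x ^ (d + 1) + 2 * c * x" for x
    unfolding f_def f_poly_def by (simp add: pderiv_add pderiv_monom poly_monom)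
  have multiplier: "poly (pderiv f) \<beta> = e - a * \<beta>" if "\<beta> \<in># proots Q" for \<beta>
  proof -
    from that have "poly Q \<beta> = 0" using \<open>Q \<noteq> 0\<close> by simp
    then have *: "\<beta> ^ (d + 1) = 1 - c * \<beta>"
      by (simp add: Q_def poly_monom algebra_simps eq_neg_iff_add_eq_0)
    show ?thesis unfolding pd * by (simp add: e_def a_def algebra_simps)
  qed
  have "proots (f - [:0, 1:]) = {#0#} + proots Q"
    using \<open>Q \<noteq> 0\<close> by (simp add: fQ proots_mult del: mult_pCons_left)
  then have "delta1_ac d = [:0, 1:] * (\<Prod>\<beta>\<in>#proots Q. [:- poly (pderiv f) \<beta>, 1:])"
    by (simp add: delta1_ac_def f_def c_def Let_def pd[unfolded f_def c_def] del: mult_pCons_left)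
  also have "(\<Prod>\<beta>\<in>#proots Q. [:- poly (pderiv f) \<beta>, 1:]) = (\<Prod>\<beta>\<in>#proots Q. [:a * \<beta> - e, 1:])"
    using multiplier by (intro arg_cong[where f = prod_mset] image_mset_cong) simp
  also have "\<dots> = smult ((- a) ^ (d + 1)) (pcompose Q [:e / a, - (1 / a):])"
    using linear_factors_substitution[OF a0, where A = "proots Q" and e = e] prod_mset_roots[OF lcQ] degQ by simp
  finally have D: "delta1_ac d = [:0, 1:] * smult ((- a) ^ (d + 1)) (pcompose Q [:e / a, - (1 / a):])" .
  have emb2: "emb 2 = 2" using emb.hom_of_nat[of 2] by simp
  have "poly (map_poly emb ?rhs) y = poly (delta1_ac d) y" for y
  proof -
    have e1: "poly (map_poly emb ?rhs) y = y * ((y - e) ^ (d + 1) - (- of_nat d) ^ d * c ^ (d + 1) * (2 - y))"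
      by (simp add: embp.hom_mult embp.hom_minus embp.hom_power emb.map_poly_hom_smult
        emb.map_poly_pCons_hom emb.hom_uminus emb.hom_minus emb2 emb.hom_add emb.hom_mult emb.hom_power emb.hom_of_nat 
        map_poly_0 c_def e_def algebra_simps del: power_Suc mult_pCons_left)
    have e2: "poly (delta1_ac d) y = y * ((- a) ^ (d + 1) * (((e - y) / a) ^ (d + 1) + (c * ((e - y) / a) - 1)))"
      by (simp add: D Q_def poly_pcompose poly_monom diff_divide_distrib algebra_simps)
    have e3: "(- a) ^ (d + 1) * ((e - y) / a) ^ (d + 1) = (y - e) ^ (d + 1)"
    proof -
      have "(- a) * ((e - y) / a) = y - e" using a0 by simp
      then show ?thesis by (simp only: flip: power_mult_distrib)
    qed
    have e4: "(- a) ^ (d + 1) * (c * ((e - y) / a) - 1) = - ((- of_nat d) ^ d * c ^ (d + 1) * (2 - y))"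
    proof -
      have "(- a) * (c * ((e - y) / a) - 1) = a - c * (e - y)"
        using a0 by (simp add: field_simps)
      also have "\<dots> = - (c * (2 - y))" by (simp add: a_def e_def algebra_simps)
      finally have "(- a) ^ (d + 1) * (c * ((e - y) / a) - 1) = (- a) ^ d * (- (c * (2 - y)))"
        by (simp only: power_add power_one_right mult.assoc)
      also have "(- a) ^ d = (- of_nat d) ^ d * c ^ d"
        by (simp add: a_def flip: power_mult_distrib)
      finally show ?thesis by (simp add: mult_ac)
    qed
    show ?thesis
      by (simp only: e1 e2 distrib_left[of "(- a) ^ (d + 1)"] e3 e4 add_uminus_conv_diff)
  qed
  then show "map_poly emb ?rhs = delta1_ac d"
    by (simp add: poly_eq_poly_eq_iff[symmetric] fun_eq_iff)
qed

text \<open>The value of \<open>\<delta>\<^sub>1\<close> at a complex number, as a polynomial in the indeterminate \<open>c\<close>.\<close>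
definition delta1_at :: "nat \<Rightarrow> complex \<Rightarrow> complex poly" where
  "delta1_at d \<zeta> = poly (map_poly of_int_poly (delta1 d)) [:\<zeta>:]"

text \<open>In the closed form of \<open>\<delta>\<^sub>1(\<zeta>)\<close> the indeterminate \<open>c\<close> occurs only in the power
  \<open>c ^ (d + 1)\<close>; everything else is constant in \<open>c\<close>.\<close>
lemma lead_coeff_delta1_at:
  assumes d: "d > 0" and "\<zeta> \<noteq> 0" "\<zeta> \<noteq> 2"
  shows "lead_coeff (delta1_at d \<zeta>) = - (\<zeta> * (- of_nat d) ^ d * (2 - \<zeta>))"
proof -
  interpret h: map_poly_inj_comm_ring_hom "of_int_poly :: int poly \<Rightarrow> complex poly" ..
  define k where "k = - (\<zeta> * (- of_nat d) ^ d * (2 - \<zeta>))"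
  have "delta1_at d \<zeta> = [:\<zeta>:] * ([:\<zeta> - of_nat (d + 2):] ^ (d + 1) -
      [:(- of_nat d) ^ d:] * [:0, 1:] ^ (d + 1) * [:2 - \<zeta>:])"
  proof -
    have two: "of_int_poly 2 = (2 :: complex poly)"
      using of_int_poly_hom.hom_of_nat[of 2] by simp
    have H: "map_poly of_int_poly (delta1 d) = [:0, 1:] * ([:- of_nat (d + 2), 1:] ^ (d + 1) -
        smult ((- of_nat d) ^ d * [:0, 1:] ^ (d + 1)) [:2, -1 :: complex poly:])"
      unfolding delta1_eq[OF d]
      by (simp only: h.hom_mult h.hom_minus h.hom_power of_int_poly_hom.map_poly_hom_smult
        of_int_poly_hom.map_poly_pCons_hom of_int_poly_hom.hom_mult of_int_poly_hom.hom_power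
        of_int_poly_hom.hom_uminus of_int_poly_hom.hom_of_nat of_int_poly_hom.hom_one
        of_int_poly_hom.hom_zero of_int_hom.hom_zero of_int_hom.hom_one map_poly_0 two
        of_int_hom.map_poly_pCons_hom)
    have c1: "- of_nat (d + 2) + [:\<zeta>:] = [:\<zeta> - of_nat (d + 2):]"
      by (simp add: of_nat_poly numeral_poly)
    have c2: "(- of_nat d) ^ d = [:(- of_nat d :: complex) ^ d:]"
      by (simp add: of_nat_poly poly_const_pow)
    have c3: "2 - [:\<zeta>:] = [:2 - \<zeta>:]"
      by (simp add: numeral_poly)
    have "delta1_at d \<zeta> = [:\<zeta>:] * ((- of_nat (d + 2) + [:\<zeta>:]) ^ (d + 1) -
        (- of_nat d) ^ d * [:0, 1:] ^ (d + 1) * (2 - [:\<zeta>:]))"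
      by (simp add: delta1_at_def H algebra_simps del: power_Suc mult_pCons_left mult_pCons_right)
    then show ?thesis unfolding c1 c2 c3 .
  qed
  also have "\<dots> = [:\<zeta> * (\<zeta> - of_nat (d + 2)) ^ (d + 1):] + monom k (d + 1)"
    by (simp add: k_def monom_altdef poly_const_pow algebra_simps smult_add_right flip: smult_power del: power_Suc) (simp flip: smult_add_left)
  finally have *: "delta1_at d \<zeta> = \<dots>" .
  have "degree [:\<zeta> * (\<zeta> - of_nat (d + 2)) ^ (d + 1):] < degree (monom k (d + 1))"
    using assms by (simp add: degree_monom_eq k_def)
  from lead_coeff_add_le[OF this] show ?thesis
    by (simp only: * k_def lead_coeff_monom)
qed

section \<open>The leading coefficient up to sign\<close>
lemma finite_primitive_roots: "n > 0 \<Longrightarrow> finite (primitive_roots_of_unity n)"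
  by (rule finite_subset[OF _ finite_roots_unity_complex]) (auto simp: primitive_roots_of_unity_def)

text \<open>The resultant formula is applied in \<open>\<complex>[c][x]\<close>, where the cyclotomic polynomial splits into
  linear factors with constant roots. For \<open>n = 1\<close>, where \<open>Delta1\<close> is a plain value, the only primitive root
  is \<open>1\<close>.\<close>
lemma of_int_poly_Delta1:
  assumes "n > 0"
  shows "of_int_poly (Delta1 d n) = (\<Prod>\<zeta>\<in>primitive_roots_of_unity n. delta1_at d \<zeta>)"
proof (cases "n = 1")
  case True
  have "primitive_roots_of_unity 1 = {1}" by (auto simp: primitive_roots_of_unity_def)
  moreover have "of_int_poly (poly (delta1 d) 1) = delta1_at d 1"
    unfolding delta1_at_def using of_int_poly_hom.poly_map_poly[of "delta1 d" 1] by (simp flip: one_pCons)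
  ultimately show ?thesis using True by (simp add: Delta1_def)
next
  case False
  let ?lift = "\<lambda>\<zeta> :: complex. [:\<zeta>:]"
  interpret lift0: comm_ring_hom ?lift by unfold_locales (simp_all add: one_pCons)
  interpret lift: map_poly_comm_ring_hom ?lift ..
  have fin: "finite (?lift ` primitive_roots_of_unity n)"
    using finite_primitive_roots[OF assms] by simp
  have "map_poly of_int_poly (map_poly (\<lambda>a. [:a:]) (cyclotomic n)) =
      map_poly ?lift (of_int_poly (cyclotomic n))"
    by (rule poly_eqI) (simp add: coeff_map_poly of_int_hom.map_poly_pCons_hom)
  also have "\<dots> = (\<Prod>\<zeta>\<in>primitive_roots_of_unity n. [:- ?lift \<zeta>, 1:])"
    unfolding of_int_poly_cyclotomic[OF assms] lift.hom_prod
    by (simp only: lift0.map_poly_pCons_hom lift0.hom_one lift0.hom_uminus map_poly_0 lift.hom_one flip: one_pCons)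
  also have "\<dots> = (\<Prod>z\<in>?lift ` primitive_roots_of_unity n. [:- z, 1:])"
    by (subst prod.reindex) (auto simp: inj_on_def)
  finally have *: "map_poly of_int_poly (map_poly (\<lambda>a. [:a:]) (cyclotomic n)) = \<dots>" .
  have "of_int_poly (Delta1 d n) = resultant (\<Prod>z\<in>?lift ` primitive_roots_of_unity n. [:- z, 1:])
      (map_poly of_int_poly (delta1 d))"
    using False by (simp add: Delta1_def * flip: of_int_poly_hom.resultant_hom)
  also have "\<dots> = (\<Prod>\<zeta>\<in>primitive_roots_of_unity n. delta1_at d \<zeta>)"
    unfolding resultant_prod_linear[OF fin] delta1_at_def
    by (subst prod.reindex) (auto simp: inj_on_def)
  finally show ?thesis .
qed

text \<open>Both sides have the sum \<open>n\<close> over the divisors of \<open>n\<close>, so strong induction isolates the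
  divisor \<open>n\<close> itself.\<close>
lemma card_primitive_roots:
  "n > 0 \<Longrightarrow> card (primitive_roots_of_unity n) = totient n"
proof (induction n rule: less_induct)
  case (less n)
  have fin: "finite {k. k dvd n}" using less.prems by simp
  have pos: "k > 0" if "k dvd n" for k using that less.prems by (auto intro: Nat.gr0I)
  have "n = card {\<zeta> :: complex. \<zeta> ^ n = 1}" using card_roots_unity_eq[of n] less.prems by simp
  also have "\<dots> = (\<Sum>k | k dvd n. card (primitive_roots_of_unity k))"
    unfolding roots_of_unity_partition[OF less.prems]
    using fin finite_primitive_roots pos primitive_roots_of_unity_disjoint
    by (intro card_UN_disjoint) auto
  finally have "(\<Sum>k | k dvd n. card (primitive_roots_of_unity k)) = (\<Sum>k | k dvd n. totient k)"
    by (simp add: totient_divisor_sum)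
  moreover have "(\<Sum>k\<in>{k. k dvd n} - {n}. card (primitive_roots_of_unity k)) = (\<Sum>k\<in>{k. k dvd n} - {n}. totient k)"
    using less.prems pos by (intro sum.cong less.IH) (auto dest: dvd_imp_le)
  ultimately show ?case
    using fin by (simp add: sum.remove[of _ n])
qed

lemma poly_cyclotomic:
  assumes "n > 0"
  shows "of_int (poly (cyclotomic n) x) = (\<Prod>\<zeta>\<in>primitive_roots_of_unity n. of_int x - \<zeta>)"
proof -
  have "of_int (poly (cyclotomic n) x) = poly (of_int_poly (cyclotomic n)) (of_int x :: complex)" by simp
  then show ?thesis by (simp add: of_int_poly_cyclotomic[OF assms] poly_prod)
qed

lemma norm_primitive_root: "\<zeta> \<in> primitive_roots_of_unity n \<Longrightarrow> n > 0 \<Longrightarrow> norm \<zeta> = 1"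
  using power_eq_1_iff by (force simp: primitive_roots_of_unity_def)

lemma abs_lead_coeff_Delta1:
  assumes d: "d > 0" and n: "n > 0"
  shows "\<bar>lead_coeff (Delta1 d n)\<bar> = int d ^ (d * totient n) * \<bar>poly (cyclotomic n) 2\<bar>"
proof -
  let ?P = "primitive_roots_of_unity n"
  have "of_int (lead_coeff (Delta1 d n)) = lead_coeff (of_int_poly (Delta1 d n) :: complex poly)" by simp
  also have "\<dots> = (\<Prod>\<zeta>\<in>?P. lead_coeff (delta1_at d \<zeta>))"
    unfolding of_int_poly_Delta1[OF n] by (rule lead_coeff_prod)
  finally have "norm (of_int (lead_coeff (Delta1 d n)) :: complex) =
      (\<Prod>\<zeta>\<in>?P. norm (lead_coeff (delta1_at d \<zeta>)))"
    by (simp only: prod_norm)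
  also have "\<dots> = (\<Prod>\<zeta>\<in>?P. real d ^ d * norm (2 - \<zeta>))"
  proof (rule prod.cong)
    fix \<zeta> assume "\<zeta> \<in> ?P"
    then have z: "norm \<zeta> = 1" using norm_primitive_root n by blast
    then have "\<zeta> \<noteq> 0" "\<zeta> \<noteq> 2" by auto
    then show "norm (lead_coeff (delta1_at d \<zeta>)) = real d ^ d * norm (2 - \<zeta>)"
      by (simp add: lead_coeff_delta1_at[OF d] norm_mult norm_power z)
  qed simp
  also have "\<dots> = real d ^ (d * totient n) * norm (\<Prod>\<zeta>\<in>?P. 2 - \<zeta>)"
    by (simp add: prod.distrib card_primitive_roots[OF n] power_mult prod_norm)
  also have "(\<Prod>\<zeta>\<in>?P. 2 - \<zeta>) = of_int (poly (cyclotomic n) 2)"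
    using poly_cyclotomic[OF n, of 2] by simp
  finally have "real_of_int \<bar>lead_coeff (Delta1 d n)\<bar> =
      real_of_int (int d ^ (d * totient n) * \<bar>poly (cyclotomic n) 2\<bar>)" by simp
  then show ?thesis by (simp only: of_int_eq_iff)
qed

section \<open>Prime divisors of cyclotomic values\<close>

lemma prod_cyclotomic_divisors:
  assumes n: "n > 0"
  shows "(\<Prod>k | k dvd n. cyclotomic k) = monom 1 n - 1"
proof -
  have fin: "finite {k. k dvd n}" using n by simp
  have pos: "k > 0" if "k dvd n" for k using that n by (auto intro: Nat.gr0I)
  have "of_int_poly (\<Prod>k | k dvd n. cyclotomic k) =
      (\<Prod>k | k dvd n. \<Prod>\<zeta>\<in>primitive_roots_of_unity k. [:- \<zeta>, 1 :: complex:])"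
    unfolding of_int_poly_hom.hom_prod using pos of_int_poly_cyclotomic by (intro prod.cong) auto
  also have "\<dots> = (\<Prod>\<zeta>\<in>(\<Union>k\<in>{k. k dvd n}. primitive_roots_of_unity k). [:- \<zeta>, 1:])"
    using fin finite_primitive_roots pos primitive_roots_of_unity_disjoint
    by (intro prod.UNION_disjoint[symmetric]) auto
  also have "\<dots> = monom 1 n - 1"
    unfolding roots_of_unity_partition[OF n, symmetric] by (rule prod_roots_of_unity[OF n])
  also have "\<dots> = of_int_poly (monom 1 n - 1 :: int poly)"
    by (simp add: hom_distribs)
  finally show ?thesis by (simp only: of_int_poly_hom.eq_iff)
qed

text \<open>Among the cyclotomic factors of \<open>x ^ n - 1\<close> are \<open>\<Phi>\<^sub>n\<close> and, besides it, all the factors of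
  \<open>x ^ r - 1\<close>. Thus \<open>\<Phi>\<^sub>n(x)\<close> divides the quotient of the two, which is a geometric sum. The condition
  \<open>x > 1\<close> allows \<open>x ^ r - 1\<close> to be cancelled.\<close>
lemma cyclotomic_dvd_geometric_sum:
  fixes x :: int
  assumes n: "n = p * r" "n > 0" "p > 1" and x: "x > 1"
  shows "poly (cyclotomic n) x dvd (\<Sum>i<p. (x ^ r) ^ i)"
proof -
  have r: "r > 0" "r < n" using n by auto
  have fin: "finite {k. k dvd n}" using n by simp
  have ev: "(\<Prod>k | k dvd m. poly (cyclotomic k) x) = x ^ m - 1" if "m > 0" for m
    using arg_cong[OF prod_cyclotomic_divisors[OF that], of "\<lambda>p. poly p x"]
    by (simp add: poly_prod poly_monom)
  have "insert n {k. k dvd r} \<subseteq> {k. k dvd n}" using n by auto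
  then have "(\<Prod>k\<in>insert n {k. k dvd r}. poly (cyclotomic k) x) dvd (\<Prod>k | k dvd n. poly (cyclotomic k) x)"
    by (rule prod_dvd_prod_subset[OF fin])
  moreover have "n \<notin> {k. k dvd r}" using r by (auto dest: dvd_imp_le)
  ultimately have "poly (cyclotomic n) x * (x ^ r - 1) dvd x ^ n - 1"
    using r n(2) by (simp add: ev)
  also have "x ^ n - 1 = (\<Sum>i<p. (x ^ r) ^ i) * (x ^ r - 1)"
    using power_diff_1_eq[of "x ^ r" p] by (simp add: n(1) mult.commute flip: power_mult)
  finally show ?thesis using one_less_power[OF x r(1)] by simp
qed

lemma cyclotomic_dvd_power_minus_one:
  assumes "n > 0"
  shows "poly (cyclotomic n) x dvd x ^ n - (1 :: int)"
proof -
  have "cyclotomic n dvd monom 1 n - 1"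
    unfolding prod_cyclotomic_divisors[OF assms, symmetric] using assms by (intro dvd_prodI) auto
  then obtain g where "monom 1 n - 1 = cyclotomic n * g" by (rule dvdE)
  from arg_cong[OF this, of "\<lambda>p. poly p x"] show ?thesis by (simp add: poly_monom)
qed

lemma geometric_sum_cong:
  fixes y q :: int
  assumes "[y = 1] (mod q)"
  shows "[(\<Sum>i<p. y ^ i) = int p] (mod q)"
proof -
  have "[(\<Sum>i<p. y ^ i) = (\<Sum>i<p. 1)] (mod q)"
    using cong_pow[OF assms] by (intro cong_sum) (metis power_one)
  then show ?thesis by simp
qed

text \<open>This is the case of the lifting-the-exponent lemma that is needed to see that \<open>q\<close> divides the sum exactly once:
  with \<open>y = 1 + q * t\<close>, the powers of \<open>y\<close> are \<open>1 + i * q * t\<close> modulo \<open>q\<^sup>2\<close>, and for odd \<open>q\<close> the linear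
  terms add up to a multiple of \<open>q * (q * t)\<close>.\<close>
lemma geometric_sum_cong_square:
  fixes y :: int and q :: nat
  assumes y: "[y = 1] (mod int q)" and q: "odd q"
  shows "[(\<Sum>i<q. y ^ i) = int q] (mod (int q)\<^sup>2)"
proof -
  obtain t where t: "y = 1 + int q * t"
    using y by (metis cong_iff_lin cong_sym mult.commute)
  have "[y ^ i = 1 + int i * (int q * t)] (mod (int q)\<^sup>2)" for i
  proof (induction i)
    case (Suc i)
    have "[y ^ Suc i = y * (1 + int i * (int q * t))] (mod (int q)\<^sup>2)"
      using cong_scalar_left[OF Suc.IH, of y] by simp
    also have "y * (1 + int i * (int q * t)) = 1 + int (Suc i) * (int q * t) + (int q)\<^sup>2 * (int i * t\<^sup>2)"
      by (simp add: t algebra_simps power2_eq_square)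
    also have "[\<dots> = 1 + int (Suc i) * (int q * t)] (mod (int q)\<^sup>2)"
      by (simp add: cong_def)
    finally show ?case .
  qed simp
  then have "[(\<Sum>i<q. y ^ i) = (\<Sum>i<q. 1 + int i * (int q * t))] (mod (int q)\<^sup>2)"
    by (intro cong_sum)
  also have "(\<Sum>i<q. 1 + int i * (int q * t)) = int q + (\<Sum>i<q. int i) * (int q * t)"
    by (simp add: sum.distrib sum_distrib_right)
  also have "(\<Sum>i<q. int i) = int q * int ((q - 1) div 2)"
  proof -
    obtain h where h: "q = 2 * h + 1" using q by (auto elim: oddE)
    have "2 * (\<Sum>i<k. int i) = int k * (int k - 1)" for k
      by (induction k) (auto simp: algebra_simps)
    from this[of q] show ?thesis by (simp add: h algebra_simps)
  qed
  also have "int q + int q * int ((q - 1) div 2) * (int q * t) =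
      int q + (int q)\<^sup>2 * (int ((q - 1) div 2) * t)"
    by (simp add: algebra_simps power2_eq_square)
  also have "[\<dots> = int q] (mod (int q)\<^sup>2)" by (simp add: cong_def)
  finally show ?thesis .
qed

text \<open>Let \<open>m\<close> be the order of \<open>2\<close> modulo \<open>q\<close>; it divides \<open>q - 1\<close> and \<open>n\<close>. If a prime \<open>p\<close> divides
  \<open>n / m\<close>, then \<open>2 ^ (n / p)\<close> is \<open>1\<close> modulo \<open>q\<close>, so the geometric sum of length \<open>p\<close> that \<open>\<Phi>\<^sub>n(2)\<close> divides is
  congruent to \<open>p\<close> modulo \<open>q\<close>, which forces \<open>p = q\<close>. So \<open>n / m\<close> is a power of \<open>q\<close>. It is not \<open>1\<close>,
  since otherwise \<open>n = m\<close> would divide \<open>q - 1\<close>. Taking \<open>p = q\<close> in the same geometric sum, now modulo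
  \<open>q\<^sup>2\<close>, shows that \<open>q\<close> divides \<open>\<Phi>\<^sub>n(2)\<close> only once.\<close>
lemma non_primitive_prime_divisor:
  fixes q :: nat
  assumes n: "n \<ge> 2" and q: "Factorial_Ring.prime q" and dvd: "int q dvd poly (cyclotomic n) 2"
    and not1: "\<not> [q = 1] (mod n)"
  obtains m k where "n = m * q ^ k" "k > 0" "m dvd q - 1"
    and "odd q" "\<not> (int q)\<^sup>2 dvd poly (cyclotomic n) 2"
proof -
  have "int q dvd 2 ^ n - 1"
    using cyclotomic_dvd_power_minus_one[of n 2] n dvd dvd_trans by simp
  moreover have "odd ((2 :: int) ^ n - 1)" using n by simp
  ultimately have "odd q" using dvd_trans even_of_nat by blast
  define m where "m = Pocklington.ord q 2"
  have pow: "[(2 :: int) ^ j = 1] (mod int q) \<longleftrightarrow> m dvd j" for j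
    using ord_divides[of 2 j q] unfolding m_def
    by (metis cong_int_iff of_nat_1 of_nat_numeral of_nat_power)
  have "m dvd n" using \<open>int q dvd 2 ^ n - 1\<close> by (simp flip: pow add: cong_iff_dvd_diff)
  have "m dvd q - 1"
    using order_divides_totient[of q 2] \<open>odd q\<close> totient_prime[OF q] by (simp add: m_def)
  have only_q: "p = q" if "Factorial_Ring.prime p" "n = p * r" "m dvd r" for p r
  proof -
    note dvd
    also have "poly (cyclotomic n) 2 dvd (\<Sum>i<p. ((2 :: int) ^ r) ^ i)"
      by (rule cyclotomic_dvd_geometric_sum[OF that(2) _ prime_gt_1_nat[OF that(1)]]) (use n in simp_all)
    finally have "int q dvd (\<Sum>i<p. ((2 :: int) ^ r) ^ i)" .
    moreover have "[(\<Sum>i<p. ((2 :: int) ^ r) ^ i) = int p] (mod int q)"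
      using that pow by (intro geometric_sum_cong) blast
    ultimately have "int q dvd int p" using cong_dvd_iff by blast
    then show ?thesis using primes_dvd_imp_eq[OF q that(1)] by simp
  qed
  obtain u where u: "n = m * u" using \<open>m dvd n\<close> by blast
  have "u > 0" using u n by (intro Nat.gr0I) auto
  then obtain k s where ks: "u = q ^ k * s" "\<not> q dvd s"
    using multiplicity_decompose'[of u q] q by (metis not_prime_unit not_gr_zero)
  have "s = 1"
  proof (rule ccontr)
    assume "s \<noteq> 1"
    then obtain p w where p: "Factorial_Ring.prime p" "s = p * w"
      using prime_factor_nat[of s] by blast
    have "p = q"
      by (rule only_q[OF p(1), of "m * q ^ k * w"]) (simp_all add: u ks p)
    then show False using ks p by simp
  qed
  then have nmk: "n = m * q ^ k" using u ks by simp
  have "k > 0"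
  proof (rule Nat.gr0I)
    assume "k = 0"
    then have "n dvd q - 1" using nmk \<open>m dvd q - 1\<close> by simp
    then have "[q = 1] (mod n)"
      using prime_gt_1_nat[OF q] by (simp add: cong_altdef_nat)
    then show False using not1 by blast
  qed
  then obtain l where l: "k = Suc l" by (cases k) auto
  define r where "r = m * q ^ l"
  have r: "n = q * r" "m dvd r" by (simp_all add: nmk l r_def)
  have "\<not> (int q)\<^sup>2 dvd poly (cyclotomic n) 2"
  proof
    assume "(int q)\<^sup>2 dvd poly (cyclotomic n) 2"
    also have "\<dots> dvd (\<Sum>i<q. ((2 :: int) ^ r) ^ i)"
      by (rule cyclotomic_dvd_geometric_sum[OF r(1) _ prime_gt_1_nat[OF q]]) (use n in simp_all)
    finally have "(int q)\<^sup>2 dvd int q"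
      using geometric_sum_cong_square[of "2 ^ r" q] \<open>odd q\<close> r(2) pow cong_dvd_iff by blast
    then have "q\<^sup>2 dvd q" by (metis of_nat_dvd_iff of_nat_power)
    then show False using prime_gt_1_nat[OF q] by (auto simp: power2_eq_square)
  qed
  with that nmk \<open>k > 0\<close> \<open>m dvd q - 1\<close> \<open>odd q\<close> show thesis by blast
qed

section \<open>Cyclotomic values at prime multiples of the index\<close>
lemma primitive_root_power_eq_one_iff:
  assumes n: "n > 0" and z: "\<zeta> \<in> primitive_roots_of_unity n"
  shows "\<zeta> ^ k = 1 \<longleftrightarrow> n dvd k"
proof
  assume k: "\<zeta> ^ k = 1"
  have zn: "\<zeta> ^ n = 1" using z by (simp add: primitive_roots_of_unity_def)
  have "\<zeta> ^ k = \<zeta> ^ (n * (k div n) + k mod n)" by simp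
  also have "\<dots> = \<zeta> ^ (k mod n)" by (simp only: power_add power_mult zn power_one mult_1)
  finally have "\<zeta> ^ (k mod n) = 1" using k by simp
  then show "n dvd k" using z n by (auto simp: primitive_roots_of_unity_def dvd_eq_mod_eq_0)
qed (use z in \<open>auto simp: primitive_roots_of_unity_def power_mult elim!: dvdE\<close>)

lemma primitive_rootI:
  assumes "n > 0" and "\<And>k. \<zeta> ^ k = 1 \<longleftrightarrow> n dvd k"
  shows "\<zeta> \<in> primitive_roots_of_unity n"
  using assms by (auto simp: primitive_roots_of_unity_def dest: dvd_imp_le)

text \<open>The order \<open>k\<close> of \<open>\<zeta>\<close> divides \<open>q * j\<close> exactly when the order \<open>r\<close> of \<open>\<zeta> ^ q\<close> divides \<open>j\<close>. Hence
  \<open>k = q * r\<close> if \<open>q\<close> divides \<open>k\<close>, and \<open>k = r\<close> otherwise.\<close>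
lemma primitive_root_prime_power_iff:
  assumes q: "Factorial_Ring.prime q" and r: "r > 0"
  shows "\<zeta> ^ q \<in> primitive_roots_of_unity r \<longleftrightarrow>
    \<zeta> \<in> primitive_roots_of_unity (q * r) \<or> (\<not> q dvd r \<and> \<zeta> \<in> primitive_roots_of_unity r)"
proof
  have q0: "q > 0" using prime_gt_0_nat[OF q] .
  {
    assume *: "\<zeta> ^ q \<in> primitive_roots_of_unity r"
    have "\<zeta> ^ (q * r) = 1"
      using primitive_root_power_eq_one_iff[OF r *, of r] by (simp add: power_mult)
    then obtain k where k: "k dvd q * r" "\<zeta> \<in> primitive_roots_of_unity k"
      using roots_of_unity_partition[of "q * r"] q0 r by auto
    have "k > 0" using k(1) q0 r by (intro Nat.gr0I) auto
    have iff: "k dvd q * j \<longleftrightarrow> r dvd j" for j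
      using primitive_root_power_eq_one_iff[OF \<open>k > 0\<close> k(2), of "q * j"]
        primitive_root_power_eq_one_iff[OF r *, of j] by (simp add: power_mult)
    show "\<zeta> \<in> primitive_roots_of_unity (q * r) \<or> (\<not> q dvd r \<and> \<zeta> \<in> primitive_roots_of_unity r)"
    proof (cases "q dvd k")
      case True
      then obtain k' where k': "k = q * k'" by blast
      have "k' = r" using iff[of k'] iff[of r] q0 by (auto simp: k' intro: dvd_antisym)
      then show ?thesis using k k' by simp
    next
      case False
      then have "coprime k q" using prime_imp_coprime[OF q] coprime_commute by blast
      then have "k dvd q * j \<longleftrightarrow> k dvd j" for j by (simp add: coprime_dvd_mult_right_iff)
      then have "k = r" using iff[of k] iff[of r] by (auto intro: dvd_antisym)
      then show ?thesis using k False by simp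
    qed
  next
    assume "\<zeta> \<in> primitive_roots_of_unity (q * r) \<or> (\<not> q dvd r \<and> \<zeta> \<in> primitive_roots_of_unity r)"
    then show "\<zeta> ^ q \<in> primitive_roots_of_unity r"
    proof (elim disjE conjE)
      assume "\<zeta> \<in> primitive_roots_of_unity (q * r)"
      then show ?thesis
        using primitive_root_power_eq_one_iff[of "q * r" \<zeta>] q0 r
        by (intro primitive_rootI) (auto simp flip: power_mult)
    next
      assume "\<not> q dvd r" and z: "\<zeta> \<in> primitive_roots_of_unity r"
      then have "coprime r q" using prime_imp_coprime[OF q] coprime_commute by blast
      then have "r dvd q * k \<longleftrightarrow> r dvd k" for k by (simp add: coprime_dvd_mult_right_iff)
      then show ?thesis
        using primitive_root_power_eq_one_iff[OF r z] r
        by (intro primitive_rootI) (simp_all flip: power_mult)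
    qed
  }
qed

text \<open>A root \<open>w\<close> of \<open>z ^ q = \<eta>\<close> reduces this to the factorization of \<open>(x / w) ^ q - 1\<close>, since the
  fibre consists of the multiples of \<open>w\<close> by the \<open>q\<close>-th roots of unity.\<close>
lemma prod_power_fibre:
  fixes x \<eta> :: complex
  assumes q: "q > 0" and \<eta>: "\<eta> \<noteq> 0"
  shows "(\<Prod>z | z ^ q = \<eta>. x - z) = x ^ q - \<eta>"
proof -
  obtain w where w: "w ^ q = \<eta>" using card_nth_roots[OF \<eta> q] q by fastforce
  then have w0: "w \<noteq> 0" using q \<eta> by (auto simp: power_0_left)
  have "(\<Prod>u | u ^ q = 1. x / w - u) = (x / w) ^ q - 1"
    using arg_cong[OF prod_roots_of_unity[OF q], of "\<lambda>p. poly p (x / w)"]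
    by (simp add: poly_prod poly_monom)
  have "bij_betw (\<lambda>u. w * u) {u. u ^ q = 1} {z. z ^ q = \<eta>}"
    by (rule bij_betwI[where g = "\<lambda>z. z / w"]) (use w w0 in \<open>auto simp: power_mult_distrib power_divide\<close>)
  then have "(\<Prod>z | z ^ q = \<eta>. x - z) = (\<Prod>u | u ^ q = 1. x - w * u)"
    by (rule prod.reindex_bij_betw[symmetric])
  also have "\<dots> = (\<Prod>u\<in>{u. u ^ q = 1}. w * (x / w - u))"
    using w0 by (intro prod.cong) (auto simp: right_diff_distrib)
  also have "\<dots> = w ^ q * ((x / w) ^ q - 1)"
    unfolding prod.distrib using card_roots_unity_eq[OF q] \<open>(\<Prod>u | u ^ q = 1. x / w - u) = _\<close> by simp
  also have "\<dots> = x ^ q - \<eta>" using w \<eta> by (simp add: power_divide field_simps)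
  finally show ?thesis .
qed

text \<open>The left side is the product of \<open>x ^ q - \<eta>\<close> over the primitive \<open>r\<close>-th roots of unity \<open>\<eta>\<close>. Each
  factor splits over the \<open>q\<close>-th roots of \<open>\<eta>\<close>, and by the preceding classification these are together
  the primitive roots of order \<open>q * r\<close> and, if \<open>q\<close> does not divide \<open>r\<close>, also those of order \<open>r\<close>.\<close>
lemma cyclotomic_prime_mult:
  assumes q: "Factorial_Ring.prime q" and r: "r > 0"
  shows "poly (cyclotomic r) (x ^ q) =
    poly (cyclotomic (q * r)) x * (if q dvd r then 1 else poly (cyclotomic r) x)"
proof -
  have q0: "q > 0" using prime_gt_0_nat[OF q] .
  let ?P = primitive_roots_of_unity
  let ?x = "of_int x :: complex"
  have fin: "finite {z :: complex. z ^ q = \<eta>}" if "\<eta> \<noteq> 0" for \<eta>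
    using q0 by (rule finite_nth_roots)
  have nz: "\<eta> \<noteq> 0" if "\<eta> \<in> ?P r" for \<eta> using norm_primitive_root[OF that r] by auto
  have "complex_of_int (poly (cyclotomic r) (x ^ q)) = (\<Prod>\<eta>\<in>?P r. ?x ^ q - \<eta>)"
    using poly_cyclotomic[OF r, of "x ^ q"] by simp
  also have "\<dots> = (\<Prod>\<eta>\<in>?P r. \<Prod>z | z ^ q = \<eta>. ?x - z)"
    using nz by (intro prod.cong) (simp_all add: prod_power_fibre[OF q0])
  also have "\<dots> = (\<Prod>z\<in>(\<Union>\<eta>\<in>?P r. {z. z ^ q = \<eta>}). ?x - z)"
    using finite_primitive_roots[OF r] fin nz by (intro prod.UNION_disjoint[symmetric]) auto
  also have "(\<Union>\<eta>\<in>?P r. {z. z ^ q = \<eta>}) = ?P (q * r) \<union> (if q dvd r then {} else ?P r)"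
    using primitive_root_prime_power_iff[OF q r] by auto
  also have "(\<Prod>z\<in>\<dots>. ?x - z) = (\<Prod>z\<in>?P (q * r). ?x - z) * (\<Prod>z\<in>(if q dvd r then {} else ?P r). ?x - z)"
    using finite_primitive_roots q0 r prime_gt_1_nat[OF q] primitive_roots_of_unity_disjoint[of "q * r" r]
    by (intro prod.union_disjoint) auto
  also have "\<dots> = of_int (poly (cyclotomic (q * r)) x * (if q dvd r then 1 else poly (cyclotomic r) x))"
    using poly_cyclotomic[of "q * r" x] poly_cyclotomic[OF r, of x] q0 r by simp
  finally show ?thesis by (simp only: of_int_eq_iff)
qed

section \<open>Lower bounds and Bang's theorem for the base 2\<close>
lemma cyclotomic_abs_bounds:
  assumes n: "n > 0" and x: "x \<ge> (2 :: int)"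
  shows "\<bar>poly (cyclotomic n) x\<bar> \<ge> (x - 1) ^ totient n" and "\<bar>poly (cyclotomic n) x\<bar> \<le> (x + 1) ^ totient n"
proof -
  let ?P = "primitive_roots_of_unity n"
  have abs: "real_of_int \<bar>poly (cyclotomic n) x\<bar> = (\<Prod>\<zeta>\<in>?P. norm (of_int x - \<zeta>))"
    using arg_cong[OF poly_cyclotomic[OF n, of x], of norm] by (simp add: prod_norm)
  have bound: "of_int x - 1 \<le> norm (of_int x - \<zeta>) \<and> norm (of_int x - \<zeta>) \<le> of_int x + 1" if "\<zeta> \<in> ?P" for \<zeta>
    using norm_primitive_root[OF that n] norm_triangle_ineq2[of "of_int x" \<zeta>] norm_triangle_ineq4[of "of_int x" \<zeta>] x
    by simp
  have "(\<Prod>\<zeta>\<in>?P. of_int x - 1) \<le> (\<Prod>\<zeta>\<in>?P. norm (of_int x - \<zeta>))"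
    using bound x by (intro prod_mono) auto
  then have "real_of_int ((x - 1) ^ totient n) \<le> real_of_int \<bar>poly (cyclotomic n) x\<bar>"
    unfolding abs by (simp add: card_primitive_roots[OF n])
  then show "\<bar>poly (cyclotomic n) x\<bar> \<ge> (x - 1) ^ totient n" by (simp only: of_int_le_iff)
  have "(\<Prod>\<zeta>\<in>?P. norm (of_int x - \<zeta>)) \<le> (\<Prod>\<zeta>\<in>?P. of_int x + 1)"
    using bound x by (intro prod_mono) auto
  then have "real_of_int \<bar>poly (cyclotomic n) x\<bar> \<le> real_of_int ((x + 1) ^ totient n)"
    unfolding abs by (simp add: card_primitive_roots[OF n])
  then show "\<bar>poly (cyclotomic n) x\<bar> \<le> (x + 1) ^ totient n" by (simp only: of_int_le_iff)
qed

text \<open>The distance from \<open>2\<close> to a point of the unit circle exceeds \<open>1\<close> unless that point is \<open>1\<close>.\<close>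
lemma cyclotomic_two_gt_one:
  assumes n: "n \<ge> 2"
  shows "\<bar>poly (cyclotomic n) 2\<bar> > 1"
proof -
  let ?P = "primitive_roots_of_unity n"
  have "norm (2 - \<zeta>) > 1" if "\<zeta> \<in> ?P" for \<zeta>
  proof -
    have z: "norm \<zeta> = 1" using norm_primitive_root that n by auto
    have "\<zeta> \<noteq> 1" using that n by (auto simp: primitive_roots_of_unity_def dest!: bspec[of _ _ 1])
    have "Re \<zeta> < 1"
    proof (rule ccontr)
      assume "\<not> Re \<zeta> < 1"
      then have "Re \<zeta> = 1" using complex_Re_le_cmod[of \<zeta>] z by simp
      moreover have "(Re \<zeta>)\<^sup>2 + (Im \<zeta>)\<^sup>2 = 1" using z by (simp flip: cmod_power2)
      ultimately show False using \<open>\<zeta> \<noteq> 1\<close> by (simp add: complex_eq_iff)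
    qed
    then show ?thesis using complex_Re_le_cmod[of "2 - \<zeta>"] by simp
  qed
  moreover have "?P \<noteq> {}" using card_primitive_roots[of n] n by force
  ultimately have "(\<Prod>\<zeta>\<in>?P. norm (2 - \<zeta>)) > 1"
    using finite_primitive_roots[of n] n by (intro less_1_prod) auto
  also have "(\<Prod>\<zeta>\<in>?P. norm (2 - \<zeta>)) = real_of_int \<bar>poly (cyclotomic n) 2\<bar>"
    using arg_cong[OF poly_cyclotomic[of n 2], of norm] n by (simp add: prod_norm)
  finally show ?thesis by simp
qed

lemma linear_less_power_two: "n \<ge> 5 \<Longrightarrow> 3 * int n + 1 < 2 ^ n"
  by (induction n rule: nat_induct_at_least) auto

text \<open>Write \<open>n = q * r\<close>. If \<open>q\<close> divides \<open>r\<close>, then \<open>\<Phi>\<^sub>n(2) = \<Phi>\<^sub>r(2 ^ q)\<close> is at least \<open>2 ^ q - 1 > q\<close>.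
  Otherwise \<open>k = 1\<close> and \<open>\<bar>\<Phi>\<^sub>n(2)\<bar> \<ge> ((2 ^ q - 1) / 3) ^ \<phi>(r)\<close>, which exceeds \<open>q\<close> as soon as \<open>q \<ge> 5\<close>. In the
  case \<open>q = 3\<close> the cofactor \<open>r = m\<close> divides \<open>2\<close>, so that \<open>n \<le> 6\<close>; this is how the exception
  \<open>\<Phi>\<^sub>6(2) = 3\<close> is avoided.\<close>
lemma cyclotomic_two_gt_prime:
  fixes q :: nat
  assumes n: "n = m * q ^ k" "n \<ge> 7" "k > 0" and m: "m dvd q - 1"
    and q: "Factorial_Ring.prime q" "odd q"
  shows "\<bar>poly (cyclotomic n) 2\<bar> > int q"
proof -
  obtain l where l: "k = Suc l" using n(3) by (cases k) auto
  define r where "r = m * q ^ l"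
  have nr: "n = q * r" by (simp add: n(1) r_def l)
  have r: "r > 0" using nr n(2) by (intro Nat.gr0I) auto
  have "q \<ge> 3" using q prime_ge_2_nat[OF q(1)] by (cases "q = 2") auto
  have lower: "\<bar>poly (cyclotomic r) (2 ^ q)\<bar> \<ge> (2 ^ q - 1) ^ totient r"
    using cyclotomic_abs_bounds(1)[OF r, of "2 ^ q"] \<open>q \<ge> 3\<close> self_le_power[of 2 q] by simp
  have t: "totient r > 0" using r by simp
  show ?thesis
  proof (cases "q dvd r")
    case True
    have "int q < 2 ^ q - 1"
      using \<open>q \<ge> 3\<close> by (induction q rule: nat_induct_at_least) auto
    also have "\<dots> \<le> (2 ^ q - 1) ^ totient r"
      using t \<open>q \<ge> 3\<close> by (intro self_le_power) auto
    also note lower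
    finally show ?thesis
      using cyclotomic_prime_mult[OF q(1) r, of 2] True by (simp add: nr)
  next
    case False
    then have "l = 0" by (cases l) (auto simp: r_def)
    then have "r \<le> q - 1" using m \<open>q \<ge> 3\<close> by (auto simp: r_def intro: dvd_imp_le)
    have "q \<ge> 5"
    proof (rule ccontr)
      assume "\<not> q \<ge> 5"
      then have "q = 3" using \<open>q \<ge> 3\<close> \<open>odd q\<close> by (cases "q = 4") auto
      then show False using \<open>r \<le> q - 1\<close> nr n(2) by simp
    qed
    let ?t = "totient r"
    have "int q * 3 ^ ?t < (2 ^ q - 1) ^ ?t"
    proof -
      have "int q * 3 ^ ?t \<le> int q ^ ?t * 3 ^ ?t"
        using t \<open>q \<ge> 3\<close> by (intro mult_right_mono self_le_power) auto
      also have "\<dots> = (3 * int q) ^ ?t" by (simp add: power_mult_distrib mult.commute)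
      also have "\<dots> < (2 ^ q - 1) ^ ?t"
        using linear_less_power_two[OF \<open>q \<ge> 5\<close>] t by (intro power_strict_mono) auto
      finally show ?thesis .
    qed
    also note lower
    also have "\<bar>poly (cyclotomic r) (2 ^ q)\<bar> = \<bar>poly (cyclotomic n) 2\<bar> * \<bar>poly (cyclotomic r) 2\<bar>"
      using cyclotomic_prime_mult[OF q(1) r, of 2] False by (simp add: nr abs_mult)
    also have "\<dots> \<le> \<bar>poly (cyclotomic n) 2\<bar> * 3 ^ ?t"
      using cyclotomic_abs_bounds(2)[OF r, of 2] by (intro mult_left_mono) auto
    finally show ?thesis by simp
  qed
qed

text \<open>Without such a prime, every prime divisor of \<open>\<Phi>\<^sub>n(2)\<close> would be the largest prime factor of
  \<open>n\<close>, hence there would be only one, \<open>q\<close>, and it would divide \<open>\<Phi>\<^sub>n(2)\<close> once. That contradicts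
  \<open>\<bar>\<Phi>\<^sub>n(2)\<bar> > q\<close>.\<close>
theorem cyclotomic_two_primitive_prime_divisor:
  assumes n: "n \<ge> 7"
  obtains q :: nat where "Factorial_Ring.prime q" "int q dvd poly (cyclotomic n) 2" "[q = 1] (mod n)"
proof (rule ccontr)
  assume "\<not> thesis"
  with that have bad: "\<not> [q = 1] (mod n)"
    if "Factorial_Ring.prime q" "int q dvd poly (cyclotomic n) 2" for q using that by blast
  define N where "N = nat \<bar>poly (cyclotomic n) 2\<bar>"
  have N: "int q dvd poly (cyclotomic n) 2 \<longleftrightarrow> q dvd N" for q
    by (simp add: N_def nat_abs_dvd_iff flip: int_dvd_int_iff)
  have "N > 1" using cyclotomic_two_gt_one[of n] n by (simp add: N_def)
  then obtain q where q: "Factorial_Ring.prime q" "q dvd N"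
    using prime_factor_nat[of N] by auto
  have factorization: "\<exists>m k. n = m * p ^ k \<and> k > 0 \<and> m dvd p - 1 \<and> odd p \<and> \<not> p\<^sup>2 dvd N"
    if "Factorial_Ring.prime p" "p dvd N" for p
    using non_primitive_prime_divisor[of n p] bad[of p] that n N[of p] N[of "p\<^sup>2"] by (simp, metis)
  \<comment> \<open>Any prime divisor \<open>p'\<close> of \<open>n = m * p ^ k\<close> divides \<open>p - 1\<close> or \<open>p\<close>.
    Used in both directions, this leaves a single prime divisor of \<open>N\<close>.\<close>
  have le: "p' \<le> p" if p: "Factorial_Ring.prime p" "p dvd N" and p': "Factorial_Ring.prime p'" "p' dvd N" for p p'
  proof -
    obtain m k where mk: "n = m * p ^ k" "m dvd p - 1" using factorization[OF p] by blast
    have "p' dvd n" using factorization[OF p'] by (metis dvd_mult dvd_power)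
    then have "p' dvd m \<or> p' dvd p"
      using p'(1) mk(1) prime_dvd_mult_iff prime_dvd_power by blast
    then have "p' dvd p - 1 \<or> p' dvd p" using mk(2) dvd_trans by blast
    then show ?thesis using prime_gt_1_nat[OF p(1)] by (auto dest: dvd_imp_le)
  qed
  obtain m k where mk: "n = m * q ^ k" "k > 0" "m dvd q - 1" "odd q" "\<not> q\<^sup>2 dvd N"
    using factorization[OF q] by blast
  obtain s where s: "N = q * s" using q by blast
  have "s = 1"
  proof (rule ccontr)
    assume "s \<noteq> 1"
    then obtain p where p: "Factorial_Ring.prime p" "p dvd s" using prime_factor_nat by blast
    then have "p dvd N" using s by simp
    then have "p = q" using le[OF q p(1)] le[OF p(1) _ q] by simp
    then show False using p s mk(5) by (auto simp: power2_eq_square)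
  qed
  then have "\<bar>poly (cyclotomic n) 2\<bar> = int q" using s by (simp add: N_def)
  moreover have "\<bar>poly (cyclotomic n) 2\<bar> > int q"
    using cyclotomic_two_gt_prime[OF mk(1) n mk(2,3) q(1) mk(4)] .
  ultimately show False by simp
qed

section \<open>The leading coefficient and its prime divisors\<close>
theorem theorem1p12:
  fixes d :: nat
  assumes "d \<ge> 3"
  shows "(\<forall>n\<ge>1.
            lead_coeff (Delta1 d n) = int d ^ (d * totient n) * poly (cyclotomic n) 2 \<or>
            lead_coeff (Delta1 d n) = - (int d ^ (d * totient n) * poly (cyclotomic n) 2)) \<and>
         (\<forall>n\<ge>7.
            \<exists>q::nat. Factorial_Ring.prime q \<and> int q dvd lead_coeff (Delta1 d n) \<and> [q = 1] (mod n))"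
proof -
  have lead: "\<bar>lead_coeff (Delta1 d n)\<bar> = \<bar>int d ^ (d * totient n) * poly (cyclotomic n) 2\<bar>" if "n \<ge> 1" for n
    using abs_lead_coeff_Delta1[of d n] assms that by (simp add: abs_mult)
  have "\<exists>q::nat. Factorial_Ring.prime q \<and> int q dvd lead_coeff (Delta1 d n) \<and> [q = 1] (mod n)"
    if n: "n \<ge> 7" for n
  proof -
    obtain q :: nat where q: "Factorial_Ring.prime q" "int q dvd poly (cyclotomic n) 2" "[q = 1] (mod n)"
      using cyclotomic_two_primitive_prime_divisor[OF n] .
    have "int q dvd \<bar>lead_coeff (Delta1 d n)\<bar>"
      using q(2) n by (subst lead) auto
    then show ?thesis using q by auto
  qed
  moreover have "lead_coeff (Delta1 d n) = int d ^ (d * totient n) * poly (cyclotomic n) 2 \<or>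
      lead_coeff (Delta1 d n) = - (int d ^ (d * totient n) * poly (cyclotomic n) 2)" if "n \<ge> 1" for n
    using lead[OF that] unfolding abs_eq_iff .
  ultimately show ?thesis by blast
qed

end
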